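(* Let $G$ be an abelian group and $K$ a field. Let $A = K(e_{1,1}+e_{3,3})\oplus Ke_{2,2}\oplus Ke_{1,2}\oplus Ke_{2,3}\oplus Ke_{1,3}$, a subalgebra of the algebra of $3\times 3$ upper triangular matrices over $K$, and suppose that $A=\bigoplus_{g\in G}A_g$ is a $G$-grading of the $K$-algebra $A$. Then $A$, as a $G$-graded algebra, is isomorphic to $A$ endowed with an elementary $G$-grading.
   Context: The $e_{i,j}$ are the matrix units of $M_3(K)$. A $G$-grading on $A$ is a vector space decomposition $A=\bigoplus_{g\in G}A_g$ with $A_gA_h\subseteq A_{gh}$ for all $g,h\in G$; an isomorphism of $G$-graded algebras is an algebra isomorphism mapping the component of degree $g$ onto the component of degree $g$ for each $g\in G$. Given a triple $(g_1,g_2,g_3)\in G^3$, the elementary $G$-grading on $A$ defined by this triple is the grading in which each matrix unit $e_{i,j}\in A$ (that is, $e_{1,2},e_{2,3},e_{1,3},e_{2,2}$) is homogeneous of degree $g_i^{-1}g_j$ and $e_{1,1}+e_{3,3}$ is homogeneous of degree $1_G$. An elementary $G$-grading is one defined in this way by some triple. *)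

theory Defs
  imports "HOL-Analysis.Analysis"
begin

definition mat_scale :: "'k::field \<Rightarrow> 'k^'n^'n \<Rightarrow> 'k^'n^'n" where
  "mat_scale c M = (\<chi> i j. c * M $ i $ j)"

interpretation mat_space: vector_space "mat_scale :: 'k::field \<Rightarrow> 'k^'n^'n \<Rightarrow> 'k^'n^'n"
  by unfold_locales (simp_all add: mat_scale_def vec_eq_iff algebra_simps)

definition mat_unit :: "'n \<Rightarrow> 'n \<Rightarrow> 'k::field^'n^'n" where
  "mat_unit i j = (\<chi> a b. if a = i \<and> b = j then 1 else 0)"

text \<open>
  The index type \<open>3\<close> has the elements \<open>1\<close>, \<open>2\<close> and \<open>3\<close>, where \<open>3\<close> is the same
  element as \<open>0\<close>. Its order is therefore not used.
\<close>

definition algA :: "('k::field^3^3) set" where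
  "algA = mat_space.span
     {mat_unit 1 1 + mat_unit 3 3, mat_unit 2 2, mat_unit 1 2, mat_unit 2 3, mat_unit 1 3}"

text \<open>
  The grading group is written additively, so that \<open>A\<^sub>g A\<^sub>h \<subseteq> A\<^bsub>gh\<^esub>\<close> becomes a condition on
  \<open>g + h\<close>, \<open>1\<^sub>G\<close> becomes \<open>0\<close>, and \<open>g\<^sub>i\<^sup>-\<^sup>1 g\<^sub>j\<close> becomes \<open>- g\<^sub>i + g\<^sub>j\<close>.
  The class \<open>group_add\<close> does not assume commutativity.
  The product of matrices is \<open>**\<close>; the operation \<open>*\<close> on the type \<open>vec\<close> is componentwise.
\<close>

definition is_grading :: "('k::field^'n^'n) set \<Rightarrow> ('g::group_add \<Rightarrow> ('k^'n^'n) set) \<Rightarrow> bool" where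
  "is_grading A \<Gamma> \<longleftrightarrow>
     (\<forall>g. mat_space.subspace (\<Gamma> g) \<and> \<Gamma> g \<subseteq> A) \<and>
     (\<forall>a\<in>A. \<exists>!x. (\<forall>g. x g \<in> \<Gamma> g) \<and> finite {g. x g \<noteq> 0} \<and> a = (\<Sum>g | x g \<noteq> 0. x g)) \<and>
     (\<forall>g h. \<forall>a\<in>\<Gamma> g. \<forall>b\<in>\<Gamma> h. a ** b \<in> \<Gamma> (g + h))"

text \<open>
  An algebra isomorphism from \<open>A\<close> to \<open>B\<close> is a map on the ambient matrix space of which only the
  values on \<open>A\<close> matter. It automatically preserves an identity element, being multiplicative and
  onto.
\<close>

definition alg_iso :: "('k::field^'n^'n) set \<Rightarrow> ('k^'n^'n) set \<Rightarrow> ('k^'n^'n \<Rightarrow> 'k^'n^'n) \<Rightarrow> bool" where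
  "alg_iso A B f \<longleftrightarrow>
     bij_betw f A B \<and>
     (\<forall>a\<in>A. \<forall>b\<in>A. f (a + b) = f a + f b) \<and>
     (\<forall>c. \<forall>a\<in>A. f (mat_scale c a) = mat_scale c (f a)) \<and>
     (\<forall>a\<in>A. \<forall>b\<in>A. f (a ** b) = f a ** f b)"

definition graded_isomorphic ::
  "('k::field^'n^'n) set \<Rightarrow> ('g \<Rightarrow> ('k^'n^'n) set) \<Rightarrow>
   ('k^'n^'n) set \<Rightarrow> ('g \<Rightarrow> ('k^'n^'n) set) \<Rightarrow> bool" where
  "graded_isomorphic A \<Gamma> B \<Delta> \<longleftrightarrow> (\<exists>f. alg_iso A B f \<and> (\<forall>g. f ` \<Gamma> g = \<Delta> g))"

text \<open>
  The matrix units contained in \<open>algA\<close> are \<open>mat_unit 1 2\<close>, \<open>mat_unit 2 3\<close>, \<open>mat_unit 1 3\<close> and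
  \<open>mat_unit 2 2\<close>. The conditions determine the grading, since these elements together with
  \<open>mat_unit 1 1 + mat_unit 3 3\<close> are a basis of \<open>algA\<close>.
\<close>

definition is_elementary_grading_by :: "'g::group_add^3 \<Rightarrow> ('g \<Rightarrow> ('k::field^3^3) set) \<Rightarrow> bool" where
  "is_elementary_grading_by t \<Gamma> \<longleftrightarrow>
     is_grading algA \<Gamma> \<and>
     (\<forall>i j. mat_unit i j \<in> (algA :: ('k^3^3) set) \<longrightarrow> mat_unit i j \<in> \<Gamma> (- t $ i + t $ j)) \<and>
     mat_unit 1 1 + mat_unit 3 3 \<in> \<Gamma> 0"

definition is_elementary_grading :: "('g::group_add \<Rightarrow> ('k::field^3^3) set) \<Rightarrow> bool" where
  "is_elementary_grading \<Gamma> \<longleftrightarrow> (\<exists>t. is_elementary_grading_by t \<Gamma>)"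

end

theory Submission
  imports Defs
begin

text \<open>
  Write \<open>E\<close> for \<open>e\<^sub>1\<^sub>1 + e\<^sub>3\<^sub>3\<close> and \<open>J\<close> for the span of
  \<open>e\<^sub>1\<^sub>2, e\<^sub>2\<^sub>3, e\<^sub>1\<^sub>3\<close>, the elements of the algebra with zero diagonal. The quotient by \<open>J\<close>
  is \<open>K \<times> K\<close>, and the point is that a grading cannot be visible there.

  Since the group is abelian, the components of a commutator are sums of commutators, and
  commutators lie in \<open>J\<close>. As \<open>e\<^sub>1\<^sub>2\<close> and \<open>e\<^sub>2\<^sub>3\<close> are commutators,
  there are homogeneous elements \<open>v\<close> and \<open>v'\<close> of \<open>J\<close>, of some degrees \<open>h\<close> and \<open>h'\<close>, such that
  \<open>v v'\<close> is a nonzero multiple of \<open>e\<^sub>1\<^sub>3\<close>. If \<open>w\<close> is homogeneous of degree \<open>g\<close> with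
  diagonal \<open>(x, y, x)\<close>, then \<open>w v v' = x (v v')\<close> and \<open>v w v' = y (v v')\<close> have degree
  \<open>g + h + h'\<close>, while \<open>v v'\<close> has degree \<open>h + h'\<close>. Hence \<open>x = y = 0\<close> as soon as \<open>g \<noteq> 0\<close>
  (\<open>diagonal_zero_if_degree_nonzero\<close>). The argument is uniform in the characteristic
  and in the torsion of the group.

  It follows that the degree \<open>0\<close> component of \<open>E\<close> is congruent to \<open>E\<close> modulo \<open>J\<close>. As \<open>J\<close> is
  nilpotent, a polynomial in this component is an idempotent \<open>e\<close> of degree \<open>0\<close> congruent to \<open>E\<close>
  (\<open>ex_idempotent_degree_zero\<close>). The Peirce spaces \<open>e A (1 - e)\<close> and \<open>(1 - e) A e\<close> are
  one-dimensional and graded, so they are spanned by homogeneous elements \<open>p\<close> and \<open>q\<close>, and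
  \<open>e, 1 - e, p, q, p q\<close> is a homogeneous basis that multiplies like the standard one
  (\<open>ex_homogeneous_basis\<close>). Conjugation by a unipotent element takes it to the standard basis, and
  the transported grading is elementary, defined by \<open>(0, deg p, deg p + deg q)\<close>.
\<close>

section \<open>Homogeneous components\<close>

lemma matrix_mult_sum_right:
  fixes a :: "'k::field^'n^'n"
  shows "a ** (\<Sum>i\<in>S. f i) = (\<Sum>i\<in>S. a ** f i)"
  by (induction S rule: infinite_finite_induct)
    (simp_all add: matrix_add_ldistrib)

lemma matrix_mult_sum_left:
  fixes a :: "'k::field^'n^'n"
  shows "(\<Sum>i\<in>S. f i) ** a = (\<Sum>i\<in>S. f i ** a)"
  by (induction S rule: infinite_finite_induct)
    (simp_all add: matrix_matrix_mult_def vec_eq_iff distrib_right sum.distrib)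

locale graded_matrix_algebra =
  fixes A :: "('k::field^'n^'n) set" and \<Gamma> :: "'g::group_add \<Rightarrow> ('k^'n^'n) set"
  assumes subspace_A: "mat_space.subspace A"
    and mult_closed: "\<And>a b. a \<in> A \<Longrightarrow> b \<in> A \<Longrightarrow> a ** b \<in> A"
    and grading: "is_grading A \<Gamma>"
begin

definition component :: "'k^'n^'n \<Rightarrow> 'g \<Rightarrow> 'k^'n^'n" where
  "component a = (THE x. (\<forall>g. x g \<in> \<Gamma> g) \<and> finite {g. x g \<noteq> 0} \<and> a = (\<Sum>g | x g \<noteq> 0. x g))"

lemma subspace_degree: "mat_space.subspace (\<Gamma> g)"
  and degree_subset: "a \<in> \<Gamma> g \<Longrightarrow> a \<in> A"
  and mult_degree: "a \<in> \<Gamma> g \<Longrightarrow> b \<in> \<Gamma> h \<Longrightarrow> a ** b \<in> \<Gamma> (g + h)"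
  using grading by (auto simp: is_grading_def)

lemma ex1_decomposition:
  assumes "a \<in> A"
  shows "\<exists>!x. (\<forall>g. x g \<in> \<Gamma> g) \<and> finite {g. x g \<noteq> 0} \<and> a = (\<Sum>g | x g \<noteq> 0. x g)"
  using grading assms unfolding is_grading_def by blast

lemma component:
  assumes "a \<in> A"
  shows component_degree: "component a g \<in> \<Gamma> g"
    and finite_support: "finite {g. component a g \<noteq> 0}"
    and sum_components: "(\<Sum>g | component a g \<noteq> 0. component a g) = a"
  using theI'[OF ex1_decomposition[OF assms]] unfolding component_def[symmetric] by auto

lemma component_in: "a \<in> A \<Longrightarrow> component a g \<in> A"
  using component_degree degree_subset by blast

lemma component_eqI:
  assumes "finite S" "\<And>g. x g \<in> \<Gamma> g" "\<And>g. g \<notin> S \<Longrightarrow> x g = 0" "a = (\<Sum>g\<in>S. x g)"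
  shows "component a = x"
proof -
  have sub: "{g. x g \<noteq> 0} \<subseteq> S" using assms(3) by blast
  have "a \<in> A" unfolding assms(4)
    by (rule mat_space.subspace_sum[OF subspace_A degree_subset[OF assms(2)]])
  moreover have "(\<Sum>g\<in>S. x g) = (\<Sum>g | x g \<noteq> 0. x g)"
    by (rule sum.mono_neutral_right) (use assms(1) sub in auto)
  moreover have "finite {g. x g \<noteq> 0}" using sub assms(1) finite_subset by blast
  ultimately show ?thesis
    unfolding component_def using assms(2,4)
    by (intro the1_equality ex1_decomposition) auto
qed

lemma component_homogeneous:
  assumes "a \<in> \<Gamma> h"
  shows "component a = (\<lambda>g. if g = h then a else 0)"
  by (rule component_eqI[where S = "{h}"])
    (use assms in \<open>auto simp: mat_space.subspace_0[OF subspace_degree]\<close>)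

lemma homogeneous_degree_unique:
  assumes "a \<in> \<Gamma> g" "a \<in> \<Gamma> h" "a \<noteq> 0"
  shows "g = h"
  using component_homogeneous[OF assms(1)] component_homogeneous[OF assms(2)] assms(3)
  by metis

lemma sum_components_superset:
  assumes "a \<in> A" "finite S" "{g. component a g \<noteq> 0} \<subseteq> S"
  shows "(\<Sum>g\<in>S. component a g) = a"
proof -
  have "(\<Sum>g\<in>S. component a g) = (\<Sum>g | component a g \<noteq> 0. component a g)"
    by (rule sum.mono_neutral_right) (use assms in auto)
  then show ?thesis using sum_components[OF assms(1)] by simp
qed

lemma component_add:
  assumes "a \<in> A" "b \<in> A"
  shows "component (a + b) = (\<lambda>g. component a g + component b g)"
proof (rule component_eqI)
  let ?S = "{g. component a g \<noteq> 0} \<union> {g. component b g \<noteq> 0}"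
  show fin: "finite ?S" using assms finite_support by simp
  show "a + b = (\<Sum>g\<in>?S. component a g + component b g)"
    using sum_components_superset[OF assms(1) fin] sum_components_superset[OF assms(2) fin]
    by (simp add: sum.distrib)
qed (use assms in \<open>auto intro: mat_space.subspace_add[OF subspace_degree] component_degree\<close>)

lemma component_diff:
  assumes "a \<in> A" "b \<in> A"
  shows "component (a - b) = (\<lambda>g. component a g - component b g)"
  using component_add[OF mat_space.subspace_diff[OF subspace_A assms] assms(2)]
  by (simp add: fun_eq_iff)

lemma component_sum:
  assumes "finite I" "\<And>i. i \<in> I \<Longrightarrow> f i \<in> A"
  shows "component (\<Sum>i\<in>I. f i) g = (\<Sum>i\<in>I. component (f i) g)"
  using assms
proof (induction I rule: finite_induct)
  case empty
  show ?case
    using component_homogeneous[OF mat_space.subspace_0[OF subspace_degree]] by simp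
next
  case (insert i I)
  then show ?case
    by (simp add: component_add mat_space.subspace_sum[OF subspace_A])
qed

text \<open>
  Multiplication by a homogeneous element only shifts degrees. As the group may be noncommutative,
  the degree of the factor is subtracted on the side on which the factor stands, here and in the
  next lemma.
\<close>

lemma component_mult_left:
  assumes "a \<in> \<Gamma> h" "b \<in> A"
  shows "component (a ** b) = (\<lambda>g. a ** component b (- h + g))"
proof (rule component_eqI)
  let ?T = "{g. component b g \<noteq> 0}"
  show "finite ((+) h ` ?T)" using finite_support[OF assms(2)] by simp
  show "a ** component b (- h + g) \<in> \<Gamma> g" for g
    using mult_degree[OF assms(1) component_degree[OF assms(2), of "- h + g"]]
    by (simp add: add.assoc[symmetric])
  show "a ** component b (- h + g) = 0" if "g \<notin> (+) h ` ?T" for g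
  proof -
    have "- h + g \<notin> ?T" using that by (metis add_minus_cancel imageI)
    then show ?thesis by simp
  qed
  have "a ** b = a ** (\<Sum>g\<in>?T. component b g)" using sum_components[OF assms(2)] by simp
  also have "\<dots> = (\<Sum>g\<in>(+) h ` ?T. a ** component b (- h + g))"
    by (simp add: matrix_mult_sum_right sum.reindex add.assoc[symmetric])
  finally show "a ** b = (\<Sum>g\<in>(+) h ` ?T. a ** component b (- h + g))" .
qed

lemma component_mult_right:
  assumes "a \<in> \<Gamma> h" "b \<in> A"
  shows "component (b ** a) = (\<lambda>g. component b (g - h) ** a)"
proof (rule component_eqI)
  let ?T = "{g. component b g \<noteq> 0}"
  let ?s = "\<lambda>g. g + h"
  show "finite (?s ` ?T)" using finite_support[OF assms(2)] by simp
  show "component b (g - h) ** a \<in> \<Gamma> g" for g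
    using mult_degree[OF component_degree[OF assms(2), of "g - h"] assms(1)] by simp
  show "component b (g - h) ** a = 0" if "g \<notin> ?s ` ?T" for g
  proof -
    have "g - h \<notin> ?T" using that by (metis diff_add_cancel imageI)
    then show ?thesis by simp
  qed
  have "b ** a = (\<Sum>g\<in>?T. component b g) ** a" using sum_components[OF assms(2)] by simp
  also have "\<dots> = (\<Sum>g\<in>?s ` ?T. component b (g - h) ** a)"
    by (simp add: matrix_mult_sum_left sum.reindex inj_on_def)
  finally show "b ** a = (\<Sum>g\<in>?s ` ?T. component b (g - h) ** a)" .
qed

text \<open>
  The degree \<open>0\<close> component of the identity acts as a left identity on every homogeneous element,
  because multiplication on the right by such an element shifts degrees; by additivity it is a
  left identity everywhere.
\<close>

lemma one_degree_zero:
  assumes "mat 1 \<in> A"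
  shows "mat 1 \<in> \<Gamma> 0"
proof -
  let ?u = "component (mat 1) 0"
  have unit: "?u ** a = a" if "a \<in> \<Gamma> g" for a g
    using component_mult_right[OF that assms] component_homogeneous[OF that]
    by (metis diff_self matrix_mul_lid)
  have "?u = ?u ** (\<Sum>g | component (mat 1) g \<noteq> 0. component (mat 1) g)"
    using sum_components[OF assms] by simp
  also have "\<dots> = (\<Sum>g | component (mat 1) g \<noteq> 0. component (mat 1) g)"
    unfolding matrix_mult_sum_right
    by (intro sum.cong refl unit[OF component_degree] assms)
  also have "\<dots> = mat 1" using sum_components[OF assms] .
  finally show ?thesis using component_degree[OF assms, of 0] by simp
qed

text \<open>
  In an abelian group \<open>a\<^sub>g b\<^sub>h\<close> and \<open>b\<^sub>h a\<^sub>g\<close> have the same degree, so they contribute to the same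
  component of \<open>a b - b a\<close>, which thus stays in any subspace that contains all commutators.
  Only \<open>a\<close> is decomposed here; this gives a single sum instead of a double one.
\<close>

lemma component_commutator:
  assumes commutative: "\<And>g h :: 'g. g + h = h + g"
    and a: "a \<in> A" and b: "b \<in> A"
  shows "component (a ** b - b ** a) k =
    (\<Sum>g | component a g \<noteq> 0. component a g ** component b (k - g) - component b (k - g) ** component a g)"
proof -
  let ?S = "{g. component a g \<noteq> 0}"
  let ?c = "\<lambda>g. component a g"
  have minus: "- g + k = k - g" for g
    using commutative[of "- g" k] by simp
  have in_A: "?c g ** b \<in> A" "b ** ?c g \<in> A" for g
    using component_in[OF a] b by (auto intro: mult_closed)
  have "a ** b - b ** a = (\<Sum>g\<in>?S. ?c g) ** b - b ** (\<Sum>g\<in>?S. ?c g)"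
    using sum_components[OF a] by simp
  also have "\<dots> = (\<Sum>g\<in>?S. ?c g ** b - b ** ?c g)"
    by (simp add: matrix_mult_sum_left matrix_mult_sum_right sum_subtractf)
  finally have "component (a ** b - b ** a) k = (\<Sum>g\<in>?S. component (?c g ** b - b ** ?c g) k)"
    using finite_support[OF a] in_A
    by (simp add: component_sum mat_space.subspace_diff[OF subspace_A])
  also have "\<dots> = (\<Sum>g\<in>?S. ?c g ** component b (k - g) - component b (k - g) ** ?c g)"
    using in_A component_mult_left[OF component_degree[OF a] b]
      component_mult_right[OF component_degree[OF a] b]
    by (simp add: component_diff minus)
  finally show ?thesis .
qed

text \<open>The form in which one-dimensional graded subspaces are used: they consist of homogeneous elements.\<close>

lemma homogeneous_if_components_proportional:
  assumes "p \<in> A" "p \<noteq> 0" "\<And>g. \<exists>c. component p g = mat_scale c p"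
  shows "\<exists>g. p \<in> \<Gamma> g"
proof -
  obtain g where g: "component p g \<noteq> 0"
    using sum_components[OF assms(1)] assms(2) by force
  obtain c where c: "component p g = mat_scale c p" using assms(3) by blast
  have "c \<noteq> 0" using c g by auto
  then have "p = mat_scale (inverse c) (component p g)" using c by simp
  then have "p \<in> \<Gamma> g"
    using mat_space.subspace_scale[OF subspace_degree component_degree[OF assms(1)]] by metis
  then show ?thesis ..
qed

end

section \<open>Transport of gradings\<close>

lemma alg_iso_sum:
  assumes iso: "alg_iso A B f" and sub: "mat_space.subspace A"
    and "\<And>i. i \<in> I \<Longrightarrow> x i \<in> A"
  shows "f (\<Sum>i\<in>I. x i) = (\<Sum>i\<in>I. f (x i))"
proof -
  have add: "f (a + b) = f a + f b" if "a \<in> A" "b \<in> A" for a b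
    using iso that by (simp add: alg_iso_def)
  have zero: "f 0 = 0"
    using add[of 0 0] mat_space.subspace_0[OF sub] by simp
  show ?thesis using assms(3)
    by (induction I rule: infinite_finite_induct)
      (simp_all add: zero add mat_space.subspace_sum[OF sub])
qed

lemma is_grading_image:
  assumes iso: "alg_iso A B f" and sub: "mat_space.subspace A" and gr: "is_grading A \<Gamma>"
  shows "is_grading B (\<lambda>g. f ` \<Gamma> g)"
proof -
  have bij: "bij_betw f A B"
    and add: "\<And>a b. a \<in> A \<Longrightarrow> b \<in> A \<Longrightarrow> f (a + b) = f a + f b"
    and scale: "\<And>c a. a \<in> A \<Longrightarrow> f (mat_scale c a) = mat_scale c (f a)"
    and mult: "\<And>a b. a \<in> A \<Longrightarrow> b \<in> A \<Longrightarrow> f (a ** b) = f a ** f b"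
    using iso by (auto simp: alg_iso_def)
  have sub\<Gamma>: "mat_space.subspace (\<Gamma> g)" and subset: "\<Gamma> g \<subseteq> A" for g
    using gr by (auto simp: is_grading_def)
  have zero: "f 0 = 0" using alg_iso_sum[OF iso sub, of "{}" "\<lambda>_. 0"] by simp
  have inj: "inj_on f A" using bij by (simp add: bij_betw_def)
  have nonzero: "f a \<noteq> 0 \<longleftrightarrow> a \<noteq> 0" if "a \<in> A" for a
    using inj_onD[OF inj, of a 0] that zero mat_space.subspace_0[OF sub] by auto
  have "mat_space.subspace (f ` \<Gamma> g)" for g
    unfolding mat_space.subspace_def
  proof (intro conjI ballI allI)
    show "0 \<in> f ` \<Gamma> g" using zero mat_space.subspace_0[OF sub\<Gamma>] by force
    show "x + y \<in> f ` \<Gamma> g" if "x \<in> f ` \<Gamma> g" "y \<in> f ` \<Gamma> g" for x y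
      using that add subset mat_space.subspace_add[OF sub\<Gamma>] by (smt (verit) image_iff subsetD)
    show "mat_scale c x \<in> f ` \<Gamma> g" if "x \<in> f ` \<Gamma> g" for c x
      using that scale subset mat_space.subspace_scale[OF sub\<Gamma>] by (smt (verit) image_iff subsetD)
  qed
  moreover have "f ` \<Gamma> g \<subseteq> B" for g using subset bij by (auto simp: bij_betw_def)
  moreover have "\<exists>!y. (\<forall>g. y g \<in> f ` \<Gamma> g) \<and> finite {g. y g \<noteq> 0} \<and> b = (\<Sum>g | y g \<noteq> 0. y g)"
    if b: "b \<in> B" for b
  proof -
    obtain a where a: "a \<in> A" "b = f a" using b bij unfolding bij_betw_def by blast
    let ?dec = "\<lambda>x. (\<forall>g. x g \<in> \<Gamma> g) \<and> finite {g. x g \<noteq> 0} \<and> a = (\<Sum>g | x g \<noteq> 0. x g)"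
    have ex1: "\<exists>!x. ?dec x" using gr a by (simp add: is_grading_def)
    then obtain x where x: "?dec x" by blast
    have transfer: "{g. f (x g) \<noteq> 0} = {g. x g \<noteq> 0}
        \<and> f (\<Sum>g | x g \<noteq> 0. x g) = (\<Sum>g | f (x g) \<noteq> 0. f (x g))"
      if "\<And>g. x g \<in> \<Gamma> g" for x
    proof -
      have "x g \<in> A" for g using that subset by blast
      then show ?thesis using nonzero by (simp add: alg_iso_sum[OF iso sub])
    qed
    show ?thesis
    proof (rule ex1I)
      show "(\<forall>g. f (x g) \<in> f ` \<Gamma> g) \<and> finite {g. f (x g) \<noteq> 0}
          \<and> b = (\<Sum>g | f (x g) \<noteq> 0. f (x g))"
        using x transfer[of x] a(2) by auto
    next
      \<comment> \<open>A decomposition of \<open>f a\<close> is pulled back along \<open>f\<close>, where uniqueness is known.\<close>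
      fix y
      assume y: "(\<forall>g. y g \<in> f ` \<Gamma> g) \<and> finite {g. y g \<noteq> 0} \<and> b = (\<Sum>g | y g \<noteq> 0. y g)"
      then have "\<forall>g. \<exists>z. z \<in> \<Gamma> g \<and> y g = f z" by blast
      then obtain z where z: "\<And>g. z g \<in> \<Gamma> g" "\<And>g. y g = f (z g)" by metis
      have "f a = f (\<Sum>g | z g \<noteq> 0. z g)"
        using y a(2) transfer[of z] z by simp
      moreover have "(\<Sum>g | z g \<noteq> 0. z g) \<in> A"
        using z(1) subset by (intro mat_space.subspace_sum[OF sub]) blast
      ultimately have "a = (\<Sum>g | z g \<noteq> 0. z g)" using inj_onD[OF inj] a(1) by blast
      then have "?dec z" using y z transfer[of z] by simp
      then have "z = x" using ex1 x by blast
      then show "y = (\<lambda>g. f (x g))" using z(2) by auto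
    qed
  qed
  moreover have "u ** v \<in> f ` \<Gamma> (g + h)" if uv: "u \<in> f ` \<Gamma> g" "v \<in> f ` \<Gamma> h" for g h u v
  proof -
    obtain a b where ab: "a \<in> \<Gamma> g" "u = f a" "b \<in> \<Gamma> h" "v = f b" using uv by blast
    have "a ** b \<in> \<Gamma> (g + h)" using gr ab by (simp add: is_grading_def)
    moreover have "a \<in> A" "b \<in> A" using ab subset by blast+
    then have "u ** v = f (a ** b)" using ab mult by simp
    ultimately show ?thesis by blast
  qed
  ultimately show ?thesis unfolding is_grading_def by (intro conjI allI ballI) assumption+
qed

section \<open>The algebra in coordinates\<close>

text \<open>
  The arguments are ordered by the powers of the radical: the diagonal first, then the two entries
  next to it, then the corner entry.
\<close>

definition tri :: "'k::field \<Rightarrow> 'k \<Rightarrow> 'k \<Rightarrow> 'k \<Rightarrow> 'k \<Rightarrow> 'k^3^3" where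
  "tri x y a b c = vector [vector [x, a, c], vector [0, y, b], vector [0, 0, x]]"

lemma tri_nth [simp]:
  "tri x y a b c $ 1 $ 1 = x" "tri x y a b c $ 1 $ 2 = a" "tri x y a b c $ 1 $ 3 = c"
  "tri x y a b c $ 2 $ 1 = 0" "tri x y a b c $ 2 $ 2 = y" "tri x y a b c $ 2 $ 3 = b"
  "tri x y a b c $ 3 $ 1 = 0" "tri x y a b c $ 3 $ 2 = 0" "tri x y a b c $ 3 $ 3 = x"
  by (simp_all add: tri_def)

lemma tri_eq_iff:
  "tri x y a b c = tri x' y' a' b' c' \<longleftrightarrow> x = x' \<and> y = y' \<and> a = a' \<and> b = b' \<and> c = c'"
  by (auto simp: vec_eq_iff forall_3)

lemma tri_mult:
  "tri x y a b c ** tri x' y' a' b' c' =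
   tri (x * x') (y * y') (x * a' + a * y') (y * b' + b * x') (x * c' + a * b' + c * x')"
  by (simp add: vec_eq_iff forall_3 matrix_matrix_mult_def sum_3)

lemma tri_add: "tri x y a b c + tri x' y' a' b' c' = tri (x + x') (y + y') (a + a') (b + b') (c + c')"
  and tri_diff: "tri x y a b c - tri x' y' a' b' c' = tri (x - x') (y - y') (a - a') (b - b') (c - c')"
  and tri_scale: "mat_scale d (tri x y a b c) = tri (d * x) (d * y) (d * a) (d * b) (d * c)"
  and tri_zero: "0 = tri 0 0 0 0 0"
  and tri_one: "mat 1 = tri 1 1 0 0 0"
  by (simp_all add: vec_eq_iff forall_3 mat_scale_def mat_def)

lemma basis_eq_tri:
  "mat_unit 1 1 + mat_unit 3 3 = tri 1 0 0 0 0" "mat_unit 2 2 = tri 0 1 0 0 0"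
  "mat_unit 1 2 = tri 0 0 1 0 0" "mat_unit 2 3 = tri 0 0 0 1 0" "mat_unit 1 3 = tri 0 0 0 0 1"
  by (simp_all add: vec_eq_iff forall_3 mat_unit_def)

lemma subspace_algA: "mat_space.subspace algA"
  unfolding algA_def by (rule mat_space.subspace_span)

lemma algA_iff: "M \<in> algA \<longleftrightarrow> (\<exists>x y a b c. M = tri x y a b c)"
proof
  let ?T = "{M. \<exists>x y a b c. M = tri x y a b c}"
  have "mat_space.subspace ?T"
    unfolding mat_space.subspace_def
    by (force simp: tri_add tri_scale tri_zero)
  then have "algA \<subseteq> ?T"
    unfolding algA_def basis_eq_tri by (intro mat_space.span_minimal) blast+
  then show "\<exists>x y a b c. M = tri x y a b c" if "M \<in> algA" using that by blast
next
  assume "\<exists>x y a b c. M = tri x y a b c"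
  then obtain x y a b c where M: "M = tri x y a b c" by blast
  have eq: "M = mat_scale x (tri 1 0 0 0 0) + mat_scale y (tri 0 1 0 0 0)
      + mat_scale a (tri 0 0 1 0 0) + mat_scale b (tri 0 0 0 1 0) + mat_scale c (tri 0 0 0 0 1)"
    by (simp add: M tri_scale tri_add)
  show "M \<in> algA" unfolding eq algA_def basis_eq_tri
    by (intro mat_space.span_add mat_space.span_scale mat_space.span_base) auto
qed

lemma tri_in_algA: "tri x y a b c \<in> algA"
  unfolding algA_iff by blast

lemma algA_eq_tri: "M \<in> algA \<Longrightarrow> M = tri (M $ 1 $ 1) (M $ 2 $ 2) (M $ 1 $ 2) (M $ 2 $ 3) (M $ 1 $ 3)"
  by (auto simp: algA_iff)

lemma mult_algA: "M \<in> algA \<Longrightarrow> N \<in> algA \<Longrightarrow> M ** N \<in> algA"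
  by (metis algA_iff tri_mult)


lemma commutator_diagonal:
  assumes "M \<in> algA" "N \<in> algA"
  shows "(M ** N - N ** M) $ 1 $ 1 = 0" "(M ** N - N ** M) $ 2 $ 2 = 0"
proof -
  obtain x y a b c x' y' a' b' c' where "M = tri x y a b c" "N = tri x' y' a' b' c'"
    using assms algA_iff by metis
  then show "(M ** N - N ** M) $ 1 $ 1 = 0" "(M ** N - N ** M) $ 2 $ 2 = 0"
    by (simp_all add: tri_mult tri_diff)
qed

section \<open>Gradings of the algebra by an abelian group\<close>

locale graded_algA = graded_matrix_algebra algA \<Gamma>
  for \<Gamma> :: "'g::ab_group_add \<Rightarrow> ('k::field^3^3) set"
begin

text \<open>
  Commutation with \<open>e\<^sub>1\<^sub>1 + e\<^sub>3\<^sub>3\<close> fixes \<open>e\<^sub>1\<^sub>2\<close> and changes the sign of \<open>e\<^sub>2\<^sub>3\<close>, so every combination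
  of these two is a commutator, and so are the summands of its components.
\<close>

lemma component_diagonal_zero:
  "component (tri 0 0 a b 0) g $ 1 $ 1 = 0" "component (tri 0 0 a b 0) g $ 2 $ 2 = 0"
proof -
  let ?E = "tri 1 0 0 0 0 :: 'k^3^3" and ?N = "tri 0 0 a (- b) 0"
  have comm: "tri 0 0 a b 0 = ?E ** ?N - ?N ** ?E"
    by (simp add: tri_mult tri_diff)
  note c = component_commutator[OF add.commute tri_in_algA tri_in_algA, of 1 0 0 0 0 0 0 a "- b" 0 g]
  note d = commutator_diagonal[OF component_in component_in, OF tri_in_algA tri_in_algA]
  show "component (tri 0 0 a b 0) g $ 1 $ 1 = 0" "component (tri 0 0 a b 0) g $ 2 $ 2 = 0"
    unfolding comm c sum_component by (simp_all only: d sum.neutral_const)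
qed

text \<open>
  The homogeneous elements \<open>v\<close> and \<open>v'\<close> below have a nonzero product in the span of \<open>e\<^sub>1\<^sub>3\<close>.
  Inserting \<open>w\<close> before \<open>v\<close> multiplies this product by the outer diagonal entry of \<open>w\<close>, and
  inserting it between \<open>v\<close> and \<open>v'\<close> multiplies it by the middle one. Both insertions move the
  degree by \<open>g\<close>, which a nonzero multiple of a homogeneous element does not allow.
\<close>

lemma diagonal_zero_if_degree_nonzero:
  assumes w: "w \<in> \<Gamma> g" and g: "g \<noteq> 0"
  shows "w $ 1 $ 1 = 0 \<and> w $ 2 $ 2 = 0"
proof -
  let ?e = "tri 0 0 1 0 0 :: 'k^3^3" and ?e' = "tri 0 0 0 1 0 :: 'k^3^3"
  have "(\<Sum>g | component ?e g \<noteq> 0. component ?e g $ 1 $ 2) = ?e $ 1 $ 2"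
    using sum_components[OF tri_in_algA] sum_component by metis
  then obtain h where h: "component ?e h $ 1 $ 2 \<noteq> 0"
    by (metis (no_types, lifting) sum.neutral tri_nth(2) zero_neq_one)
  have "(\<Sum>g | component ?e' g \<noteq> 0. component ?e' g $ 2 $ 3) = ?e' $ 2 $ 3"
    using sum_components[OF tri_in_algA] sum_component by metis
  then obtain h' where h': "component ?e' h' $ 2 $ 3 \<noteq> 0"
    by (metis (no_types, lifting) sum.neutral tri_nth(6) zero_neq_one)
  define v v' where "v = component ?e h" and "v' = component ?e' h'"
  have deg: "v \<in> \<Gamma> h" "v' \<in> \<Gamma> h'"
    by (simp_all add: v_def v'_def component_degree tri_in_algA)
  obtain \<alpha> \<beta> \<gamma> where v: "v = tri 0 0 \<alpha> \<beta> \<gamma>" and \<alpha>: "\<alpha> \<noteq> 0"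
    using algA_eq_tri[OF degree_subset[OF deg(1)]] h component_diagonal_zero v_def by metis
  obtain \<alpha>' \<beta>' \<gamma>' where v': "v' = tri 0 0 \<alpha>' \<beta>' \<gamma>'" and \<beta>': "\<beta>' \<noteq> 0"
    using algA_eq_tri[OF degree_subset[OF deg(2)]] h' component_diagonal_zero v'_def by metis
  obtain x y a b c where w_tri: "w = tri x y a b c"
    using degree_subset[OF w] algA_iff by metis
  have vanish: "d = 0" if "mat_scale d (v ** v') \<in> \<Gamma> (g + h + h')" for d
  proof (rule ccontr)
    assume "d \<noteq> 0"
    then have "mat_scale d (v ** v') \<noteq> 0"
      using \<alpha> \<beta>' by (simp add: v v' tri_mult tri_scale tri_zero tri_eq_iff)
    moreover have "mat_scale d (v ** v') \<in> \<Gamma> (h + h')"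
      by (rule mat_space.subspace_scale[OF subspace_degree mult_degree[OF deg]])
    ultimately have "g + h + h' = h + h'"
      using homogeneous_degree_unique that by blast
    then show False using g by simp
  qed
  have "w ** v ** v' = mat_scale x (v ** v')" "v ** w ** v' = mat_scale y (v ** v')"
    by (simp_all add: v v' w_tri tri_mult tri_scale tri_eq_iff)
  then have "mat_scale x (v ** v') \<in> \<Gamma> (g + h + h')" "mat_scale y (v ** v') \<in> \<Gamma> (g + h + h')"
    using mult_degree[OF mult_degree[OF w deg(1)] deg(2)]
      mult_degree[OF mult_degree[OF deg(1) w] deg(2)] by (simp_all add: add.commute)
  then show ?thesis using vanish w_tri by simp
qed

text \<open>
  All components of \<open>e\<^sub>1\<^sub>1 + e\<^sub>3\<^sub>3\<close> of nonzero degree have zero diagonal, so its component \<open>z\<close> of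
  degree \<open>0\<close> has the diagonal \<open>(1, 0, 1)\<close>. An element with this diagonal and the entries \<open>a\<close>, \<open>b\<close>
  above it is idempotent exactly if its corner entry is \<open>- (a * b)\<close>; the polynomial
  \<open>3 z\<^sup>2 - 2 z\<^sup>3\<close>, the usual one for lifting idempotents modulo an ideal, makes this correction.
\<close>

lemma ex_idempotent_degree_zero: "\<exists>a b. tri 1 0 a b (- (a * b)) \<in> \<Gamma> 0"
proof -
  let ?E = "tri 1 0 0 0 0 :: 'k^3^3"
  let ?S = "insert 0 {g. component ?E g \<noteq> 0}"
  \<comment> \<open>The degree \<open>0\<close> is added to the support because the component might be \<open>0\<close> a priori.\<close>
  have diag: "component ?E 0 $ i $ i = ?E $ i $ i" if i: "i = 1 \<or> i = 2" for i
  proof -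
    have fin: "finite ?S" using finite_support[OF tri_in_algA] by simp
    have "(\<Sum>g\<in>?S. component ?E g $ i $ i) = ?E $ i $ i"
      using sum_components_superset[OF tri_in_algA fin] sum_component by (metis subset_insertI)
    moreover have "component ?E g $ i $ i = 0" if "g \<noteq> 0" for g
      using diagonal_zero_if_degree_nonzero[OF component_degree[OF tri_in_algA] that] i by blast
    ultimately show ?thesis using fin by (simp add: sum.remove[where x = 0])
  qed
  obtain a b c where E0: "component ?E 0 = tri 1 0 a b c"
    using algA_eq_tri[OF component_in[OF tri_in_algA]] diag tri_nth(1,5) by metis
  have deg: "tri 1 0 a b c \<in> \<Gamma> 0"
    using component_degree[OF tri_in_algA] E0 by metis
  have deg2: "tri 1 0 a b c ** tri 1 0 a b c \<in> \<Gamma> 0"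
    using mult_degree[OF deg deg] by simp
  have deg3: "tri 1 0 a b c ** tri 1 0 a b c ** tri 1 0 a b c \<in> \<Gamma> 0"
    using mult_degree[OF deg2 deg] by simp
  have "mat_scale 3 (tri 1 0 a b c ** tri 1 0 a b c)
      - mat_scale 2 (tri 1 0 a b c ** tri 1 0 a b c ** tri 1 0 a b c) \<in> \<Gamma> 0"
    by (intro mat_space.subspace_diff mat_space.subspace_scale subspace_degree deg2 deg3)
  moreover have "mat_scale 3 (tri 1 0 a b c ** tri 1 0 a b c)
      - mat_scale 2 (tri 1 0 a b c ** tri 1 0 a b c ** tri 1 0 a b c) = tri 1 0 a b (- (a * b))"
    by (simp add: tri_mult tri_scale tri_diff tri_eq_iff algebra_simps)
  ultimately show ?thesis by metis
qed

text \<open>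
  With \<open>e\<close> the idempotent of degree \<open>0\<close>, the third and fourth elements are
  \<open>e e\<^sub>1\<^sub>2 (1 - e)\<close> and \<open>(1 - e) e\<^sub>2\<^sub>3 e\<close>. The Peirce space of each is cut out by equations
  \<open>e M = M, M e = 0\<close> or the reverse, which pass to the components of \<open>M\<close> because \<open>e\<close>
  has degree \<open>0\<close>, and whose solutions form a line.
\<close>

lemma ex_homogeneous_basis:
  "\<exists>a b g h. tri 1 0 a b (- (a * b)) \<in> \<Gamma> 0 \<and> tri 0 1 (- a) (- b) (a * b) \<in> \<Gamma> 0 \<and>
     tri 0 0 1 0 (- b) \<in> \<Gamma> g \<and> tri 0 0 0 1 (- a) \<in> \<Gamma> h \<and> tri 0 0 0 0 1 \<in> \<Gamma> (g + h)"
proof -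
  obtain a b where e: "tri 1 0 a b (- (a * b)) \<in> \<Gamma> 0"
    using ex_idempotent_degree_zero by blast
  let ?e = "tri 1 0 a b (- (a * b))" and ?p = "tri 0 0 1 0 (- b)" and ?q = "tri 0 0 0 1 (- a)"
  have one: "mat 1 \<in> \<Gamma> 0" by (rule one_degree_zero) (simp add: tri_one tri_in_algA)
  have e': "tri 0 1 (- a) (- b) (a * b) \<in> \<Gamma> 0"
    using mat_space.subspace_diff[OF subspace_degree one e] by (simp add: tri_one tri_diff)
  have left: "component (?e ** M) k = ?e ** component M k" if "M \<in> algA" for M k
    using component_mult_left[OF e that] by simp
  have right: "component (M ** ?e) k = component M k ** ?e" if "M \<in> algA" for M k
    using component_mult_right[OF e that] by simp
  have zero: "component (0 :: 'k^3^3) k = 0" for k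
    using component_homogeneous[OF mat_space.subspace_0[OF subspace_degree]] by simp
  have "\<exists>c. component ?p k = mat_scale c ?p" for k
  proof -
    obtain x y \<alpha> \<beta> \<gamma> where M: "component ?p k = tri x y \<alpha> \<beta> \<gamma>"
      using component_in[OF tri_in_algA] algA_iff by metis
    have "?e ** ?p = ?p" "?p ** ?e = 0" by (simp_all add: tri_mult tri_zero)
    then have "?e ** tri x y \<alpha> \<beta> \<gamma> = tri x y \<alpha> \<beta> \<gamma>" "tri x y \<alpha> \<beta> \<gamma> ** ?e = 0"
      using left[OF tri_in_algA, of 0 0 1 0 "- b" k] right[OF tri_in_algA, of 0 0 1 0 "- b" k] zero M
      by auto
    then have "tri x y \<alpha> \<beta> \<gamma> = mat_scale \<alpha> ?p"
      by (auto simp: tri_mult tri_zero tri_eq_iff tri_scale eq_neg_iff_add_eq_0 add.commute)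
    then show ?thesis using M by metis
  qed
  then obtain g where g: "?p \<in> \<Gamma> g"
    using homogeneous_if_components_proportional[OF tri_in_algA, of 0 0 1 0 "- b"]
    by (auto simp: tri_zero tri_eq_iff)
  have "\<exists>c. component ?q k = mat_scale c ?q" for k
  proof -
    obtain x y \<alpha> \<beta> \<gamma> where M: "component ?q k = tri x y \<alpha> \<beta> \<gamma>"
      using component_in[OF tri_in_algA] algA_iff by metis
    have "?e ** ?q = 0" "?q ** ?e = ?q" by (simp_all add: tri_mult tri_zero)
    then have "?e ** tri x y \<alpha> \<beta> \<gamma> = 0" "tri x y \<alpha> \<beta> \<gamma> ** ?e = tri x y \<alpha> \<beta> \<gamma>"
      using left[OF tri_in_algA, of 0 0 0 1 "- a" k] right[OF tri_in_algA, of 0 0 0 1 "- a" k] zero M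
      by auto
    then have "tri x y \<alpha> \<beta> \<gamma> = mat_scale \<beta> ?q"
      by (auto simp: tri_mult tri_zero tri_eq_iff tri_scale eq_neg_iff_add_eq_0 algebra_simps)
    then show ?thesis using M by metis
  qed
  then obtain h where h: "?q \<in> \<Gamma> h"
    using homogeneous_if_components_proportional[OF tri_in_algA, of 0 0 0 1 "- a"]
    by (auto simp: tri_zero tri_eq_iff)
  have "tri 0 0 0 0 1 \<in> \<Gamma> (g + h)"
    using mult_degree[OF g h] by (simp add: tri_mult)
  then show ?thesis using e e' g h by blast
qed

end

lemma alg_iso_conj_algA:
  fixes U V :: "'k::field^3^3"
  assumes "U \<in> algA" "V \<in> algA" "U ** V = mat 1" "V ** U = mat 1"
  shows "alg_iso algA algA (\<lambda>M. U ** M ** V)"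
proof -
  have cancel: "U ** (V ** M ** U) ** V = M" "V ** (U ** M ** V) ** U = M" for M
    using assms(3,4) by (metis matrix_mul_assoc matrix_mul_lid matrix_mul_rid)+
  have "bij_betw (\<lambda>M. U ** M ** V) algA algA"
    by (rule bij_betw_byWitness[where f' = "\<lambda>M. V ** M ** U"])
      (use assms(1,2) in \<open>auto simp: cancel intro!: mult_algA\<close>)
  moreover have "U ** (M + N) ** V = U ** M ** V + U ** N ** V" for M N
    using matrix_mult_sum_left[of "\<lambda>i. if i then U ** M else U ** N" UNIV V]
    by (simp add: matrix_add_ldistrib UNIV_bool add.commute)
  moreover have "U ** mat_scale c M ** V = mat_scale c (U ** M ** V)" for c M
    by (simp add: vec_eq_iff mat_scale_def matrix_matrix_mult_def sum_distrib_left sum_distrib_right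
        algebra_simps)
  moreover have "U ** (M ** N) ** V = (U ** M ** V) ** (U ** N ** V)" for M N
    using assms(4) by (metis matrix_mul_assoc matrix_mul_rid)
  ultimately show ?thesis unfolding alg_iso_def by blast
qed

lemma mat_unit_in_algA:
  assumes "mat_unit i j \<in> (algA :: ('k::field^3^3) set)"
  shows "(i, j) \<in> {(1, 2), (2, 3), (1, 3), (2, 2)}"
proof -
  obtain x y a b c where eq: "mat_unit i j = (tri x y a b c :: 'k^3^3)"
    using assms algA_iff by metis
  have "i = 1 \<or> i = 2 \<or> i = 3" "j = 1 \<or> j = 2 \<or> j = 3" by (simp_all add: exhaust_3)
  then show ?thesis using eq
    by (auto simp: vec_eq_iff forall_3 mat_unit_def)
qed

theorem theorem1:
  fixes \<Gamma> :: "'g::ab_group_add \<Rightarrow> ('k::field^3^3) set"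
  assumes "is_grading algA \<Gamma>"
  shows "\<exists>\<Delta>. is_elementary_grading \<Delta> \<and> graded_isomorphic algA \<Gamma> algA \<Delta>"
proof -
  interpret graded_algA \<Gamma>
    by unfold_locales (use assms in \<open>simp_all add: subspace_algA mult_algA\<close>)
  obtain a b g h where e: "tri 1 0 a b (- (a * b)) \<in> \<Gamma> 0"
    and e': "tri 0 1 (- a) (- b) (a * b) \<in> \<Gamma> 0"
    and p: "tri 0 0 1 0 (- b) \<in> \<Gamma> g" and q: "tri 0 0 0 1 (- a) \<in> \<Gamma> h"
    and pq: "tri 0 0 0 0 1 \<in> \<Gamma> (g + h)"
    using ex_homogeneous_basis by blast
  \<comment> \<open>\<open>V\<close> is the unipotent matrix for which \<open>V E V\<^sup>-\<^sup>1\<close> is the idempotent found above, and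
      \<open>U\<close> is its inverse; conjugation by \<open>U\<close> then takes the whole homogeneous basis to the
      standard one.\<close>
  define U V where "U = tri 1 1 a (- b) (- (a * b))" and "V = tri 1 1 (- a) b 0"
  define f where "f = (\<lambda>M. U ** M ** V)"
  have iso: "alg_iso algA algA f"
    unfolding f_def
    by (rule alg_iso_conj_algA) (simp_all add: U_def V_def tri_in_algA tri_mult tri_one)
  have f: "f (tri 1 0 a b (- (a * b))) = tri 1 0 0 0 0" "f (tri 0 1 (- a) (- b) (a * b)) = tri 0 1 0 0 0"
    "f (tri 0 0 1 0 (- b)) = tri 0 0 1 0 0" "f (tri 0 0 0 1 (- a)) = tri 0 0 0 1 0"
    "f (tri 0 0 0 0 1) = tri 0 0 0 0 1"
    by (simp_all add: f_def U_def V_def tri_mult)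
  let ?\<Delta> = "\<lambda>k. f ` \<Gamma> k"
  \<comment> \<open>Consecutive differences are the degrees of \<open>e\<^sub>1\<^sub>2\<close> and \<open>e\<^sub>2\<^sub>3\<close>.\<close>
  let ?t = "vector [0, g, g + h] :: 'g^3"
  have deg: "tri 1 0 0 0 0 \<in> ?\<Delta> 0" "tri 0 1 0 0 0 \<in> ?\<Delta> 0" "tri 0 0 1 0 0 \<in> ?\<Delta> g"
    "tri 0 0 0 1 0 \<in> ?\<Delta> h" "tri 0 0 0 0 1 \<in> ?\<Delta> (g + h)"
    using f e e' p q pq by (metis imageI)+
  have "is_elementary_grading_by ?t ?\<Delta>"
    unfolding is_elementary_grading_by_def
  proof (intro conjI allI impI)
    show "is_grading algA ?\<Delta>" by (rule is_grading_image[OF iso subspace_algA assms])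
    show "mat_unit i j \<in> ?\<Delta> (- ?t $ i + ?t $ j)" if "mat_unit i j \<in> (algA :: ('k^3^3) set)" for i j
      using mat_unit_in_algA[OF that] deg by (auto simp: basis_eq_tri)
    show "mat_unit 1 1 + mat_unit 3 3 \<in> ?\<Delta> 0" using deg by (simp add: basis_eq_tri)
  qed
  then show ?thesis
    using iso unfolding is_elementary_grading_def graded_isomorphic_def by blast
qed

end
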